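(* Let $X$ and $Y$ be prebornological spaces and let $f\colon X\to Y$ be a map. The following are equivalent: (1) $f$ is proper; (2) for every $x\in X$, $({}^{\ast}f)^{-1}\left(G_{Y}\left(f(x)\right)\right)\subseteq G_{X}(x)$.
   Context: Nonstandard setting: fix a transitive universe $\mathbb{U}$ (the standard universe) satisfying sufficiently many axioms of ZFC and containing all standard objects considered, and a $|\mathbb{U}|^{+}$-saturated enlargement $\ast\colon\mathbb{U}\hookrightarrow{}^{\ast}\mathbb{U}$ (so transfer, i.e. elementary extension, and saturation are available). A standard set $X$ is regarded as a subset of ${}^{\ast}X$ by identifying $x$ with ${}^{\ast}x$. A prebornology on a set $X$ is a nonempty $\mathcal{B}_{X}\subseteq\mathcal{P}(X)$ such that (i) $\bigcup\mathcal{B}_{X}=X$; (ii) $B\in\mathcal{B}_{X}$ and $C\subseteq B$ imply $C\in\mathcal{B}_{X}$; (iii) $B,C\in\mathcal{B}_{X}$ and $B\cap C\neq\varnothing$ imply $B\cup C\in\mathcal{B}_{X}$. The pair $(X,\mathcal{B}_{X})$ is a prebornological space; elements of $\mathcal{B}_{X}$ are called bounded sets. For $x\in X$, $\mathcal{BN}_{X}(x)=\{B\in\mathcal{B}_{X}: x\in B\}$, and the galaxy of $x$ is $G_{X}(x)=\bigcup_{B\in\mathcal{BN}_{X}(x)}{}^{\ast}B\subseteq{}^{\ast}X$. A map $f\colon X\to Y$ between prebornological spaces is proper if $f^{-1}(B)\in\mathcal{B}_{X}$ for every $B\in\mathcal{B}_{Y}$. *)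

theory Defs
  imports Main "HOL-Library.Equipollence" "HOL-Library.FuncSet"
begin

section \<open>First-order formulas in the language of set theory\<close>

datatype fm =
    Mem nat nat
  | Eq nat nat
  | Neg fm
  | And fm fm
  | Ex nat fm

primrec sat :: "('a \<Rightarrow> 'a \<Rightarrow> bool) \<Rightarrow> fm \<Rightarrow> (nat \<Rightarrow> 'a) \<Rightarrow> bool" where
  "sat M (Mem i j) \<rho> \<longleftrightarrow> M (\<rho> i) (\<rho> j)"
| "sat M (Eq i j) \<rho> \<longleftrightarrow> \<rho> i = \<rho> j"
| "sat M (Neg \<phi>) \<rho> \<longleftrightarrow> \<not> sat M \<phi> \<rho>"
| "sat M (And \<phi> \<psi>) \<rho> \<longleftrightarrow> sat M \<phi> \<rho> \<and> sat M \<psi> \<rho>"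
| "sat M (Ex i \<phi>) \<rho> \<longleftrightarrow> (\<exists>x. sat M \<phi> (\<rho>(i := x)))"


section \<open>Standard and nonstandard universes\<close>

text \<open>
  A transitive set \<open>\<bbbU>\<close> is represented by a type \<open>'u\<close> with a well-founded extensional
  relation \<open>mem\<close> (by Mostowski's collapse these are, up to isomorphism, exactly the
  structures given by a transitive set with its membership relation).
  The axioms required of \<open>\<bbbU>\<close> are those of ZFC without replacement, so that
  besides the transitive models of ZFC also every \<open>V\<^sub>\<lambda>\<close> with \<open>\<lambda> > \<omega>\<close> a limit is covered.
  In the separation schema, \<open>\<rho>\<close> supplies the parameters and variable 0 is the element tested.
\<close>

locale standard_universe =
  fixes mem :: "'u \<Rightarrow> 'u \<Rightarrow> bool"  (infix "\<epsilon>" 50)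
  assumes foundation: "wfp mem"
    and extensionality: "(\<forall>z. z \<epsilon> a \<longleftrightarrow> z \<epsilon> b) \<Longrightarrow> a = b"
    and pairing: "\<exists>c. \<forall>z. z \<epsilon> c \<longleftrightarrow> z = a \<or> z = b"
    and union: "\<exists>c. \<forall>z. z \<epsilon> c \<longleftrightarrow> (\<exists>b. b \<epsilon> a \<and> z \<epsilon> b)"
    and power_set: "\<exists>c. \<forall>b. b \<epsilon> c \<longleftrightarrow> (\<forall>z. z \<epsilon> b \<longrightarrow> z \<epsilon> a)"
    and infinity: "\<exists>w. (\<exists>e. e \<epsilon> w \<and> (\<forall>z. \<not> z \<epsilon> e)) \<and>
        (\<forall>a. a \<epsilon> w \<longrightarrow> (\<exists>s. s \<epsilon> w \<and> (\<forall>z. z \<epsilon> s \<longleftrightarrow> z \<epsilon> a \<or> z = a)))"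
    and separation: "\<exists>b. \<forall>z. z \<epsilon> b \<longleftrightarrow> z \<epsilon> a \<and> sat mem \<phi> (\<rho>(0 := z))"
    and choice: "\<lbrakk>\<forall>b. b \<epsilon> a \<longrightarrow> (\<exists>z. z \<epsilon> b);
        \<forall>b c. b \<epsilon> a \<and> c \<epsilon> a \<and> b \<noteq> c \<longrightarrow> \<not> (\<exists>z. z \<epsilon> b \<and> z \<epsilon> c)\<rbrakk>
        \<Longrightarrow> \<exists>s. \<forall>b. b \<epsilon> a \<longrightarrow> (\<exists>!z. z \<epsilon> b \<and> z \<epsilon> s)"

definition ext :: "('a \<Rightarrow> 'a \<Rightarrow> bool) \<Rightarrow> 'a \<Rightarrow> 'a set" where
  "ext M a = {z. M z a}"

text \<open>
  \<open>nmem\<close> is the membership relation of \<open>\<^sup>*\<bbbU>\<close>; it need not be well-founded.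
  Saturation is the usual finite intersection property for families of internal sets
  (the extensions of elements of \<open>\<^sup>*\<bbbU>\<close>), for families of cardinality at most \<open>|\<bbbU>|\<close>,
  that is, smaller than \<open>|\<bbbU>|\<^sup>+\<close>. Applied to the families \<open>{\<^sup>*a | a \<in> A}\<close>,
  it says in particular that \<open>\<^sup>*\<bbbU>\<close> is an enlargement.
\<close>

locale nonstandard_universe = standard_universe mem
  for mem :: "'u \<Rightarrow> 'u \<Rightarrow> bool" +
  fixes nmem :: "'v \<Rightarrow> 'v \<Rightarrow> bool" and star :: "'u \<Rightarrow> 'v"
  assumes transfer: "sat mem \<phi> \<rho> \<longleftrightarrow> sat nmem \<phi> (\<lambda>i. star (\<rho> i))"
    and saturation: "\<lbrakk>F \<lesssim> (UNIV :: 'u set);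
        \<And>F0. F0 \<subseteq> F \<Longrightarrow> finite F0 \<Longrightarrow> (\<Inter>a\<in>F0. ext nmem a) \<noteq> {}\<rbrakk>
        \<Longrightarrow> (\<Inter>a\<in>F. ext nmem a) \<noteq> {}"


section \<open>Standard objects and their nonstandard extensions\<close>

text \<open>
  Standard sets of points are HOL sets over \<open>'u\<close>. The next definitions say when a set of points,
  a family of sets of points, and a map (through its graph, with Kuratowski pairs)
  is an element of the universe.
\<close>

definition set_in_universe :: "('u \<Rightarrow> 'u \<Rightarrow> bool) \<Rightarrow> 'u set \<Rightarrow> bool" where
  "set_in_universe mem A \<longleftrightarrow> (\<exists>a. ext mem a = A)"

definition family_in_universe :: "('u \<Rightarrow> 'u \<Rightarrow> bool) \<Rightarrow> 'u set set \<Rightarrow> bool" where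
  "family_in_universe mem \<A> \<longleftrightarrow> (\<exists>b. ext mem ` ext mem b = \<A>)"

definition is_pair :: "('a \<Rightarrow> 'a \<Rightarrow> bool) \<Rightarrow> 'a \<Rightarrow> 'a \<Rightarrow> 'a \<Rightarrow> bool" where
  "is_pair M p x y \<longleftrightarrow> (\<exists>s d. ext M s = {x} \<and> ext M d = {x, y} \<and> ext M p = {s, d})"

definition graph :: "('u \<Rightarrow> 'u \<Rightarrow> bool) \<Rightarrow> 'u set \<Rightarrow> ('u \<Rightarrow> 'u) \<Rightarrow> 'u set" where
  "graph mem X f = {p. \<exists>x\<in>X. is_pair mem p x (f x)}"

definition map_in_universe :: "('u \<Rightarrow> 'u \<Rightarrow> bool) \<Rightarrow> 'u set \<Rightarrow> ('u \<Rightarrow> 'u) \<Rightarrow> bool" where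
  "map_in_universe mem X f \<longleftrightarrow> set_in_universe mem (graph mem X f)"

text \<open>
  \<open>star_set\<close> and \<open>star_map\<close> are meaningful for sets and maps in the universe. The element
  with extension \<open>A\<close> is unique by extensionality, and by transfer \<open>\<^sup>*f\<close> is
  a function on \<open>\<^sup>*X\<close>; outside \<open>\<^sup>*X\<close> the value of \<open>star_map\<close> is unspecified.
\<close>

definition star_set ::
  "('u \<Rightarrow> 'u \<Rightarrow> bool) \<Rightarrow> ('v \<Rightarrow> 'v \<Rightarrow> bool) \<Rightarrow> ('u \<Rightarrow> 'v) \<Rightarrow> 'u set \<Rightarrow> 'v set" where
  "star_set mem nmem star A = ext nmem (star (THE a. ext mem a = A))"

definition star_map ::
  "('u \<Rightarrow> 'u \<Rightarrow> bool) \<Rightarrow> ('v \<Rightarrow> 'v \<Rightarrow> bool) \<Rightarrow> ('u \<Rightarrow> 'v) \<Rightarrow> 'u set \<Rightarrow> ('u \<Rightarrow> 'u) \<Rightarrow> 'v \<Rightarrow> 'v" where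
  "star_map mem nmem star X f v =
     (THE w. \<exists>p \<in> star_set mem nmem star (graph mem X f). is_pair nmem p v w)"


section \<open>Prebornological spaces\<close>

definition prebornology :: "'a set \<Rightarrow> 'a set set \<Rightarrow> bool" where
  "prebornology X \<B> \<longleftrightarrow> \<B> \<noteq> {} \<and> \<B> \<subseteq> Pow X \<and> \<Union>\<B> = X \<and>
     (\<forall>B C. B \<in> \<B> \<and> C \<subseteq> B \<longrightarrow> C \<in> \<B>) \<and>
     (\<forall>B C. B \<in> \<B> \<and> C \<in> \<B> \<and> B \<inter> C \<noteq> {} \<longrightarrow> B \<union> C \<in> \<B>)"

definition proper_map :: "'a set \<Rightarrow> 'a set set \<Rightarrow> 'b set set \<Rightarrow> ('a \<Rightarrow> 'b) \<Rightarrow> bool" where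
  "proper_map X \<B>X \<B>Y f \<longleftrightarrow> (\<forall>B\<in>\<B>Y. {x \<in> X. f x \<in> B} \<in> \<B>X)"

definition bounded_nbhds :: "'a set set \<Rightarrow> 'a \<Rightarrow> 'a set set" where
  "bounded_nbhds \<B> x = {B \<in> \<B>. x \<in> B}"

definition galaxy ::
  "('u \<Rightarrow> 'u \<Rightarrow> bool) \<Rightarrow> ('v \<Rightarrow> 'v \<Rightarrow> bool) \<Rightarrow> ('u \<Rightarrow> 'v) \<Rightarrow> 'u set set \<Rightarrow> 'u \<Rightarrow> 'v set" where
  "galaxy mem nmem star \<B> x = (\<Union>B\<in>bounded_nbhds \<B> x. star_set mem nmem star B)"

end

theory Submission
  imports Defs
begin

text \<open>
  Two facts carry the equivalence. The first is pure transfer: the standard set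
  \<open>f\<inverse>(B)\<close> satisfies \<open>\<^sup>*(f\<inverse>(B)) = (\<^sup>*f)\<inverse>(\<^sup>*B)\<close>
  (\<open>star_map_in_star_set_iff\<close>). The second is where saturation enters: a set \<open>A \<subseteq> X\<close> of the
  universe with \<open>x \<in> A\<close> is bounded if and only if \<open>\<^sup>*A \<subseteq> G(x)\<close> (\<open>bounded_iff_star_subset_galaxy\<close>).
  Indeed, if no bounded \<open>C \<ni> x\<close> covers \<open>A\<close>, then no finite number of them does, because a
  finite union of bounded sets through \<open>x\<close> is bounded; hence the sets \<open>A - C\<close> have the finite
  intersection property, and saturation yields a point of \<open>\<^sup>*A\<close> outside \<open>G(x)\<close>.

  An empty preimage is bounded. A nonempty preimage \<open>f\<inverse>(B)\<close> contains some \<open>x\<close>, and then \<open>B\<close> is a bounded neighbourhood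
  of \<open>f x\<close>. So \<open>f\<close> is proper if and only if \<open>f\<inverse>(B)\<close> is bounded for all \<open>x \<in> X\<close> and all bounded
  \<open>B \<ni> f x\<close>. By the two facts this says \<open>(\<^sup>*f)\<inverse>(\<^sup>*B) \<subseteq> G(x)\<close>, and the union
  over all such \<open>B\<close> is the inclusion \<open>(\<^sup>*f)\<inverse>(G(f x)) \<subseteq> G(x)\<close>.
\<close>

section \<open>Formulas\<close>

definition All :: "nat \<Rightarrow> fm \<Rightarrow> fm" where
  "All i \<phi> = Neg (Ex i (Neg \<phi>))"

definition Imp :: "fm \<Rightarrow> fm \<Rightarrow> fm" where
  "Imp \<phi> \<psi> = Neg (And \<phi> (Neg \<psi>))"

definition Iff :: "fm \<Rightarrow> fm \<Rightarrow> fm" where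
  "Iff \<phi> \<psi> = And (Imp \<phi> \<psi>) (Imp \<psi> \<phi>)"

definition Or :: "fm \<Rightarrow> fm \<Rightarrow> fm" where
  "Or \<phi> \<psi> = Neg (And (Neg \<phi>) (Neg \<psi>))"

lemma sat_connectives [simp]:
  "sat M (All i \<phi>) \<rho> \<longleftrightarrow> (\<forall>x. sat M \<phi> (\<rho>(i := x)))"
  "sat M (Imp \<phi> \<psi>) \<rho> \<longleftrightarrow> (sat M \<phi> \<rho> \<longrightarrow> sat M \<psi> \<rho>)"
  "sat M (Iff \<phi> \<psi>) \<rho> \<longleftrightarrow> (sat M \<phi> \<rho> \<longleftrightarrow> sat M \<psi> \<rho>)"
  "sat M (Or \<phi> \<psi>) \<rho> \<longleftrightarrow> (sat M \<phi> \<rho> \<or> sat M \<psi> \<rho>)"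
  by (auto simp: All_def Imp_def Iff_def Or_def)

text \<open>
  The bound variables 10, 11, 12 stand for the singleton, the doubleton and the element tested,
  so the free variables have to be smaller than 10.
\<close>

definition Pair_fm :: "nat \<Rightarrow> nat \<Rightarrow> nat \<Rightarrow> fm" where
  "Pair_fm p x y = Ex 10 (Ex 11
     (And (All 12 (Iff (Mem 12 10) (Eq 12 x)))
     (And (All 12 (Iff (Mem 12 11) (Or (Eq 12 x) (Eq 12 y))))
          (All 12 (Iff (Mem 12 p) (Or (Eq 12 10) (Eq 12 11)))))))"

lemma sat_Pair_fm [simp]:
  assumes "p < 10" "x < 10" "y < 10"
  shows "sat M (Pair_fm p x y) \<rho> \<longleftrightarrow> is_pair M (\<rho> p) (\<rho> x) (\<rho> y)"
  using assms by (simp add: Pair_fm_def is_pair_def ext_def set_eq_iff)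

lemma is_pair_inject:
  assumes "is_pair M p x y" "is_pair M p x' y'"
  shows "x = x' \<and> y = y'"
proof -
  obtain s d where "ext M s = {x}" "ext M d = {x, y}" "ext M p = {s, d}"
    using assms(1) by (auto simp: is_pair_def)
  moreover obtain s' d' where "ext M s' = {x'}" "ext M d' = {x', y'}" "ext M p = {s', d'}"
    using assms(2) by (auto simp: is_pair_def)
  ultimately show ?thesis
    by (metis doubleton_eq_iff singleton_insert_inj_eq)
qed


section \<open>Standard sets and transfer\<close>

context standard_universe
begin

lemma ext_inject: "ext mem a = ext mem b \<longleftrightarrow> a = b"
  using extensionality[of a b] by (auto simp: ext_def set_eq_iff)

lemma ex_ext_doubleton: "\<exists>c. ext mem c = {a, b}"
  using pairing[of a b] by (auto simp: ext_def set_eq_iff)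

lemma ex_is_pair: "\<exists>p. is_pair mem p x y"
  unfolding is_pair_def using ex_ext_doubleton by (metis insert_absorb2)

lemma ex_ext_separation: "\<exists>b. ext mem b = {z \<in> ext mem a. sat mem \<phi> (\<rho>(0 := z))}"
  using separation[of a \<phi> \<rho>] by (auto simp: ext_def set_eq_iff)

lemma ex_ext_diff: "\<exists>d. ext mem d = ext mem a - ext mem c"
proof -
  obtain d where "ext mem d = {z \<in> ext mem a. sat mem (Neg (Mem 0 1)) ((\<lambda>_. c)(0 := z))}"
    using ex_ext_separation by blast
  then have "ext mem d = ext mem a - ext mem c"
    by (auto simp: ext_def)
  then show ?thesis ..
qed

lemma is_pair_in_graph_iff:
  assumes "x \<in> X"
  shows "(\<exists>p \<in> graph mem X f. is_pair mem p x y) \<longleftrightarrow> y = f x"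
  using assms ex_is_pair[of x "f x"] by (auto simp: graph_def dest: is_pair_inject)

lemma set_in_universe_vimage:
  assumes "set_in_universe mem X" "map_in_universe mem X f" "set_in_universe mem B"
  shows "set_in_universe mem {x \<in> X. f x \<in> B}"
proof -
  obtain c g b where c: "ext mem c = X" and g: "ext mem g = graph mem X f" and b: "ext mem b = B"
    using assms by (auto simp: set_in_universe_def map_in_universe_def)
  let ?\<phi> = "Ex 3 (Ex 4 (And (Mem 4 1) (And (Mem 3 2) (Pair_fm 4 0 3))))"
  obtain a where "ext mem a = {z \<in> X. sat mem ?\<phi> ((\<lambda>i. [c, g, b] ! i)(0 := z))}"
    using ex_ext_separation c by blast
  also have "\<dots> = {z \<in> X. \<exists>w. w \<in> B \<and> (\<exists>p \<in> graph mem X f. is_pair mem p z w)}"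
    by (auto simp flip: g b simp: ext_def)
  also have "\<dots> = {x \<in> X. f x \<in> B}"
    by (simp add: is_pair_in_graph_iff cong: conj_cong)
  finally show ?thesis
    by (auto simp: set_in_universe_def)
qed

end

context nonstandard_universe
begin

lemma star_set_ext: "star_set mem nmem star (ext mem a) = ext nmem (star a)"
  by (simp add: star_set_def ext_inject)

lemma star_mem_iff: "nmem (star a) (star b) \<longleftrightarrow> mem a b"
  using transfer[of "Mem 0 1" "\<lambda>i. [a, b] ! i"] by simp

lemma star_set_mono:
  assumes "set_in_universe mem A" "set_in_universe mem B" "A \<subseteq> B"
  shows "star_set mem nmem star A \<subseteq> star_set mem nmem star B"
proof -
  obtain a b where ab: "A = ext mem a" "B = ext mem b"
    using assms by (auto simp: set_in_universe_def)
  have "sat mem (All 2 (Imp (Mem 2 0) (Mem 2 1))) (\<lambda>i. [a, b] ! i)"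
    using assms(3) by (auto simp: ab ext_def)
  then have "ext nmem (star a) \<subseteq> ext nmem (star b)"
    unfolding transfer by (auto simp: ext_def)
  then show ?thesis
    by (simp add: ab star_set_ext)
qed

lemma ext_star_diff:
  assumes "ext mem d = ext mem a - ext mem c"
  shows "ext nmem (star d) = ext nmem (star a) - ext nmem (star c)"
proof -
  have "sat mem (All 3 (Iff (Mem 3 0) (And (Mem 3 1) (Neg (Mem 3 2))))) (\<lambda>i. [d, a, c] ! i)"
    using assms by (auto simp: ext_def set_eq_iff)
  then show ?thesis
    unfolding transfer by (auto simp: ext_def)
qed

text \<open>
  One transferred sentence says both that \<open>f\<close> is single-valued and total on \<open>X\<close>, which gives
  \<open>\<^sup>*f\<close> its meaning, and that its value lies in \<open>B\<close> exactly for the points of \<open>f\<inverse>(B)\<close>.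
\<close>

lemma star_map_in_star_set_iff:
  assumes X: "set_in_universe mem X" and f: "map_in_universe mem X f"
    and B: "set_in_universe mem B" and v: "v \<in> star_set mem nmem star X"
  shows "star_map mem nmem star X f v \<in> star_set mem nmem star B \<longleftrightarrow>
    v \<in> star_set mem nmem star {x \<in> X. f x \<in> B}"
proof -
  obtain c g b a where c: "ext mem c = X" and g: "ext mem g = graph mem X f"
    and b: "ext mem b = B" and a: "ext mem a = {x \<in> X. f x \<in> B}"
    using X f B set_in_universe_vimage[OF X f B]
    by (auto simp: set_in_universe_def map_in_universe_def)
  let ?\<phi> = "All 4 (Imp (Mem 4 0) (Ex 5 (And
      (All 6 (Iff (Ex 7 (And (Mem 7 1) (Pair_fm 7 4 6))) (Eq 6 5)))
      (Iff (Mem 5 2) (Mem 4 3)))))"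
  have "\<exists>w. (\<forall>y. (\<exists>p. mem p g \<and> is_pair mem p z y) \<longleftrightarrow> y = w) \<and> (mem w b \<longleftrightarrow> mem z a)"
    if "mem z c" for z
  proof -
    have z: "z \<in> X"
      using that c by (auto simp: ext_def)
    have "(\<exists>p. mem p g \<and> is_pair mem p z y) \<longleftrightarrow> y = f z" for y
      using is_pair_in_graph_iff[OF z, of f y] by (auto simp flip: g simp: ext_def)
    moreover have "mem (f z) b \<longleftrightarrow> mem z a"
      using z a b by (auto simp: ext_def)
    ultimately show ?thesis
      by blast
  qed
  then have "sat mem ?\<phi> (\<lambda>i. [c, g, b, a] ! i)"
    by simp
  then have "sat nmem ?\<phi> (\<lambda>i. star ([c, g, b, a] ! i))"
    by (simp only: transfer)
  moreover have "nmem v (star c)"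
    using v unfolding c[symmetric] star_set_ext by (simp add: ext_def)
  ultimately obtain w
    where w: "\<And>y. (\<exists>p. nmem p (star g) \<and> is_pair nmem p v y) \<longleftrightarrow> y = w"
      and wb: "nmem w (star b) \<longleftrightarrow> nmem v (star a)"
    by auto
  have "star_map mem nmem star X f v = (THE y. \<exists>p. nmem p (star g) \<and> is_pair nmem p v y)"
    unfolding star_map_def g[symmetric] star_set_ext by (simp add: ext_def Bex_def)
  then have "star_map mem nmem star X f v = w"
    by (simp add: w)
  then show ?thesis
    using wb unfolding a[symmetric] unfolding b[symmetric] star_set_ext by (simp add: ext_def)
qed

end


section \<open>Bounded sets and galaxies\<close>

lemma set_in_universe_member:
  "family_in_universe mem \<B> \<Longrightarrow> B \<in> \<B> \<Longrightarrow> set_in_universe mem B"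
  by (auto simp: family_in_universe_def set_in_universe_def)

lemma empty_bounded: "prebornology X \<B> \<Longrightarrow> {} \<in> \<B>"
  unfolding prebornology_def by blast

lemma bounded_subset: "prebornology X \<B> \<Longrightarrow> B \<in> \<B> \<Longrightarrow> C \<subseteq> B \<Longrightarrow> C \<in> \<B>"
  unfolding prebornology_def by blast

lemma Un_bounded:
  "prebornology X \<B> \<Longrightarrow> B \<in> \<B> \<Longrightarrow> C \<in> \<B> \<Longrightarrow> x \<in> B \<Longrightarrow> x \<in> C \<Longrightarrow> B \<union> C \<in> \<B>"
  unfolding prebornology_def by blast

lemma ex_bounded_nbhd:
  "prebornology X \<B> \<Longrightarrow> x \<in> X \<Longrightarrow> \<exists>B. B \<in> bounded_nbhds \<B> x"
  unfolding prebornology_def bounded_nbhds_def by blast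

text \<open>
  A union of two bounded sets is known to be bounded only if they meet; the sets here all meet
  in \<open>x\<close>.
\<close>

lemma Union_bounded_nbhds:
  assumes "prebornology X \<B>" "finite \<C>" "\<C> \<noteq> {}" "\<C> \<subseteq> bounded_nbhds \<B> x"
  shows "\<Union>\<C> \<in> bounded_nbhds \<B> x"
  using assms(2-4)
proof (induction rule: finite_ne_induct)
  case (insert C \<C>)
  then show ?case
    using Un_bounded[OF assms(1), of C "\<Union>\<C>" x] by (auto simp: bounded_nbhds_def)
qed simp

context nonstandard_universe
begin

text \<open>
  The saturation argument. The family in question is indexed by elements of the standard
  universe, which bounds its cardinality. Finite intersections are seen to be nonempty already
  in the standard universe, because an uncovered point of \<open>A\<close> is a point of \<open>\<^sup>*A\<close>.
\<close>

lemma bounded_if_star_subset_galaxy: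
  assumes fam: "family_in_universe mem \<B>" and born: "prebornology X \<B>"
    and A: "set_in_universe mem A" and x: "x \<in> X"
    and sub: "star_set mem nmem star A \<subseteq> galaxy mem nmem star \<B> x"
  shows "A \<in> \<B>"
proof (rule ccontr)
  assume unbounded: "A \<notin> \<B>"
  obtain a where a: "ext mem a = A"
    using A by (auto simp: set_in_universe_def)
  define D where "D = {d. \<exists>C \<in> bounded_nbhds \<B> x. ext mem d = A - C}"
  have diff_in_D: "\<exists>d \<in> D. ext mem d = A - ext mem c" if "ext mem c \<in> bounded_nbhds \<B> x" for c
    using ex_ext_diff[of a c] that by (auto simp: D_def a)
  have fip: "(\<Inter>d\<in>D0. ext mem d) \<noteq> {}" if "finite D0" "D0 \<subseteq> D" "D0 \<noteq> {}" for D0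
  proof -
    have "\<forall>d \<in> D0. \<exists>C. C \<in> bounded_nbhds \<B> x \<and> ext mem d = A - C"
      using that(2) by (auto simp: D_def)
    then obtain C where C: "\<forall>d \<in> D0. C d \<in> bounded_nbhds \<B> x \<and> ext mem d = A - C d"
      using bchoice[of D0 "\<lambda>d C. C \<in> bounded_nbhds \<B> x \<and> ext mem d = A - C"] by blast
    have "\<Union>(C ` D0) \<in> bounded_nbhds \<B> x"
      by (rule Union_bounded_nbhds[OF born]) (use that C in auto)
    then have "\<not> A \<subseteq> \<Union>(C ` D0)"
      using unbounded bounded_subset[OF born] by (auto simp: bounded_nbhds_def)
    then show ?thesis
      using C by auto
  qed
  have "(\<Inter>s \<in> star ` D. ext nmem s) \<noteq> {}"
  proof (rule saturation)
    show "star ` D \<lesssim> (UNIV :: 'u set)"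
      by (rule lepoll_trans[OF image_lepoll subset_imp_lepoll]) simp
  next
    fix F0
    assume "F0 \<subseteq> star ` D" "finite F0"
    then obtain D0 where D0: "D0 \<subseteq> D" "finite D0" "F0 = star ` D0"
      by (meson finite_subset_image)
    show "(\<Inter>s \<in> F0. ext nmem s) \<noteq> {}"
    proof (cases "D0 = {}")
      case False
      then obtain z where "\<forall>d \<in> D0. mem z d"
        using fip[OF D0(2,1)] by (auto simp: ext_def)
      then have "star z \<in> (\<Inter>s \<in> F0. ext nmem s)"
        by (simp add: D0(3) ext_def star_mem_iff)
      then show ?thesis
        by blast
    qed (simp add: D0(3))
  qed
  then obtain v where v: "\<And>d. d \<in> D \<Longrightarrow> v \<in> ext nmem (star d)"
    by auto
  have v_diff: "v \<in> star_set mem nmem star A - star_set mem nmem star C"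
    if C: "C \<in> bounded_nbhds \<B> x" for C
  proof -
    have "set_in_universe mem C"
      using C set_in_universe_member[OF fam] by (simp add: bounded_nbhds_def)
    then obtain c where c: "ext mem c = C"
      by (auto simp: set_in_universe_def)
    then obtain d where "d \<in> D" "ext mem d = ext mem a - ext mem c"
      using diff_in_D[of c] C a by auto
    then show ?thesis
      using v ext_star_diff by (metis a c star_set_ext)
  qed
  moreover obtain C where "C \<in> bounded_nbhds \<B> x"
    using ex_bounded_nbhd[OF born x] ..
  ultimately have "v \<in> star_set mem nmem star A - galaxy mem nmem star \<B> x"
    by (auto simp: galaxy_def)
  then show False
    using sub by blast
qed

lemma bounded_iff_star_subset_galaxy:
  assumes "family_in_universe mem \<B>" "prebornology X \<B>" "set_in_universe mem A"
    and "A \<subseteq> X" "x \<in> A"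
  shows "A \<in> \<B> \<longleftrightarrow> star_set mem nmem star A \<subseteq> galaxy mem nmem star \<B> x"
proof
  assume "A \<in> \<B>"
  then show "star_set mem nmem star A \<subseteq> galaxy mem nmem star \<B> x"
    using assms(5) by (auto simp: galaxy_def bounded_nbhds_def)
next
  assume "star_set mem nmem star A \<subseteq> galaxy mem nmem star \<B> x"
  then show "A \<in> \<B>"
    using bounded_if_star_subset_galaxy assms by blast
qed

end

lemma proper_map_iff_nbhds:
  assumes "prebornology X \<B>X"
  shows "proper_map X \<B>X \<B>Y f \<longleftrightarrow>
    (\<forall>x\<in>X. \<forall>B \<in> bounded_nbhds \<B>Y (f x). {z \<in> X. f z \<in> B} \<in> \<B>X)"
proof
  assume nbhds: "\<forall>x\<in>X. \<forall>B \<in> bounded_nbhds \<B>Y (f x). {z \<in> X. f z \<in> B} \<in> \<B>X"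
  show "proper_map X \<B>X \<B>Y f"
    unfolding proper_map_def
  proof
    fix B
    assume "B \<in> \<B>Y"
    show "{z \<in> X. f z \<in> B} \<in> \<B>X"
    proof (cases "{z \<in> X. f z \<in> B} = {}")
      case True
      show ?thesis
        unfolding True using assms by (rule empty_bounded)
    next
      case False
      then show ?thesis
        using nbhds \<open>B \<in> \<B>Y\<close> by (auto simp: bounded_nbhds_def)
    qed
  qed
qed (auto simp: proper_map_def bounded_nbhds_def)


section \<open>Proper maps and galaxies\<close>

theorem theorem2p26:
  fixes mem :: "'u \<Rightarrow> 'u \<Rightarrow> bool" and nmem :: "'v \<Rightarrow> 'v \<Rightarrow> bool" and star :: "'u \<Rightarrow> 'v"
    and X Y :: "'u set" and \<B>X \<B>Y :: "'u set set" and f :: "'u \<Rightarrow> 'u"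
  assumes "nonstandard_universe mem nmem star"
    and "set_in_universe mem X" and "family_in_universe mem \<B>X"
    and "set_in_universe mem Y" and "family_in_universe mem \<B>Y"
    and "map_in_universe mem X f"
    and "prebornology X \<B>X" and "prebornology Y \<B>Y"
    and "f \<in> X \<rightarrow> Y"
  shows "proper_map X \<B>X \<B>Y f \<longleftrightarrow>
    (\<forall>x\<in>X. {v \<in> star_set mem nmem star X.
               star_map mem nmem star X f v \<in> galaxy mem nmem star \<B>Y (f x)}
            \<subseteq> galaxy mem nmem star \<B>X x)"
proof -
  interpret nonstandard_universe mem nmem star
    by fact
  let ?S = "star_set mem nmem star"
  let ?F = "star_map mem nmem star X f"
  let ?G = "galaxy mem nmem star \<B>X"
  have preimage: "{z \<in> X. f z \<in> B} \<in> \<B>X \<longleftrightarrow> {v \<in> ?S X. ?F v \<in> ?S B} \<subseteq> ?G x"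
    if x: "x \<in> X" and B: "B \<in> bounded_nbhds \<B>Y (f x)" for x B
  proof -
    have uB: "set_in_universe mem B" and fx: "f x \<in> B"
      using B set_in_universe_member[OF assms(5)] by (simp_all add: bounded_nbhds_def)
    have uA: "set_in_universe mem {z \<in> X. f z \<in> B}"
      using set_in_universe_vimage[OF assms(2,6) uB] .
    then have "?S {z \<in> X. f z \<in> B} \<subseteq> ?S X"
      by (rule star_set_mono[OF _ assms(2)]) auto
    then have "?S {z \<in> X. f z \<in> B} = {v \<in> ?S X. ?F v \<in> ?S B}"
      using star_map_in_star_set_iff[OF assms(2,6) uB] by auto
    moreover have "{z \<in> X. f z \<in> B} \<in> \<B>X \<longleftrightarrow> ?S {z \<in> X. f z \<in> B} \<subseteq> ?G x"
      by (rule bounded_iff_star_subset_galaxy[OF assms(3,7) uA]) (use x fx in auto)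
    ultimately show ?thesis
      by simp
  qed
  have "proper_map X \<B>X \<B>Y f \<longleftrightarrow>
      (\<forall>x\<in>X. \<forall>B \<in> bounded_nbhds \<B>Y (f x). {v \<in> ?S X. ?F v \<in> ?S B} \<subseteq> ?G x)"
    using preimage by (simp add: proper_map_iff_nbhds[OF assms(7)])
  also have "\<dots> \<longleftrightarrow>
      (\<forall>x\<in>X. {v \<in> ?S X. ?F v \<in> galaxy mem nmem star \<B>Y (f x)} \<subseteq> ?G x)"
    unfolding galaxy_def[of _ _ _ \<B>Y] by blast
  finally show ?thesis .
qed

end
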